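(* Let $d>1$ be an integer, let $r>0$, $\lambda>0$, let $N\geq 3^d$ be an integer, and let the $\mathbf{o}$-symmetric convex body $\mathbf{K}$ be a generating set in $\mathbb{R}^d$. If $Q=\{\mathbf{q}_1,\dots,\mathbf{q}_N\}\subset\mathbb{R}^d$ is a uniform contraction of $P=\{\mathbf{p}_1,\dots,\mathbf{p}_N\}\subset\mathbb{R}^d$ with separating value $\lambda$ in $\mathbb{M}^d_{\mathbf{K}}$, then $$V_d(P^r_{\mathbf{K}})\leq V_d(Q^r_{\mathbf{K}}).$$
   Context: An $\mathbf{o}$-symmetric convex body $\mathbf{K}\subset\mathbb{R}^d$ is a compact convex set with nonempty interior that is symmetric about the origin $\mathbf{o}$. It generates the norm $\|\mathbf{x}\|_{\mathbf{K}}:=\min\{\mu\geq 0 \mid \mathbf{x}\in\mu\mathbf{K}\}$, and $\mathbb{M}^d_{\mathbf{K}}$ denotes $\mathbb{R}^d$ equipped with this norm. For $\mathbf{x}\in\mathbb{R}^d$ and $r>0$, $B_{\mathbf{K}}[\mathbf{x},r]:=\mathbf{x}+r\mathbf{K}$. For $X\subseteq\mathbb{R}^d$ and $r>0$, $X^r_{\mathbf{K}}:=\bigcap\{B_{\mathbf{K}}[\mathbf{x},r]\mid \mathbf{x}\in X\}$. A nonempty compact convex set $A'\subset\mathbb{R}^d$ is a summand of a nonempty compact convex set $A\subset\mathbb{R}^d$ if there is a nonempty compact convex set $A''\subset\mathbb{R}^d$ with $A'+A''=A$ (Minkowski sum). A convex body $\mathbf{B}\subset\mathbb{R}^d$ is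 a generating set if any nonempty intersection of (a nonempty family of) translates of $\mathbf{B}$ is a summand of $\mathbf{B}$. The labeled point set $Q=\{\mathbf{q}_1,\dots,\mathbf{q}_N\}$ is a uniform contraction of the labeled point set $P=\{\mathbf{p}_1,\dots,\mathbf{p}_N\}$ with separating value $\lambda>0$ in $\mathbb{M}^d_{\mathbf{K}}$ if $\|\mathbf{q}_i-\mathbf{q}_j\|_{\mathbf{K}}\leq\lambda\leq\|\mathbf{p}_i-\mathbf{p}_j\|_{\mathbf{K}}$ for all $1\leq i<j\leq N$. $V_d(\cdot)$ is Lebesgue measure in $\mathbb{R}^d$, with $V_d(\emptyset)=0$. *)

theory Defs
  imports "HOL-Analysis.Analysis" "HOL-Library.Set_Algebras"
begin

definition convex_body :: "'a::euclidean_space set \<Rightarrow> bool" where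
  "convex_body K \<longleftrightarrow> compact K \<and> convex K \<and> interior K \<noteq> {}"

definition o_symmetric :: "'a::euclidean_space set \<Rightarrow> bool" where
  "o_symmetric K \<longleftrightarrow> uminus ` K = K"

(* The least element exists whenever K is an o-symmetric convex body; LEAST is unspecified otherwise. *)
definition body_norm :: "'a::euclidean_space set \<Rightarrow> 'a \<Rightarrow> real" where
  "body_norm K x = (LEAST \<mu>. 0 \<le> \<mu> \<and> x \<in> (\<lambda>y. \<mu> *\<^sub>R y) ` K)"

definition body_ball :: "'a::euclidean_space set \<Rightarrow> 'a \<Rightarrow> real \<Rightarrow> 'a set" where
  "body_ball K x r = (\<lambda>y. x + r *\<^sub>R y) ` K"

definition ball_polyhedron :: "'a::euclidean_space set \<Rightarrow> real \<Rightarrow> 'a set \<Rightarrow> 'a set" where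
  "ball_polyhedron K r X = (\<Inter>x\<in>X. body_ball K x r)"

(* The sum of sets is the Minkowski sum of Set_Algebras. *)
definition summand :: "'a::euclidean_space set \<Rightarrow> 'a set \<Rightarrow> bool" where
  "summand A' A \<longleftrightarrow>
     A' \<noteq> {} \<and> compact A' \<and> convex A' \<and>
     A \<noteq> {} \<and> compact A \<and> convex A \<and>
     (\<exists>A''. A'' \<noteq> {} \<and> compact A'' \<and> convex A'' \<and> A' + A'' = A)"

(* A nonempty, possibly infinite, family of translates of B is given by its set T of
   translation vectors. *)
definition generating_set :: "'a::euclidean_space set \<Rightarrow> bool" where
  "generating_set B \<longleftrightarrow>
     convex_body B \<and>
     (\<forall>T. T \<noteq> {} \<longrightarrow> (\<Inter>t\<in>T. (\<lambda>y. t + y) ` B) \<noteq> {} \<longrightarrow>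
        summand (\<Inter>t\<in>T. (\<lambda>y. t + y) ` B) B)"

(* A labeled point set {p_1, ..., p_N} is a function p on the labels 1, ..., N; different
   labels may carry the same point. *)
definition uniform_contraction ::
  "'a::euclidean_space set \<Rightarrow> real \<Rightarrow> nat \<Rightarrow> (nat \<Rightarrow> 'a) \<Rightarrow> (nat \<Rightarrow> 'a) \<Rightarrow> bool" where
  "uniform_contraction K lam N q p \<longleftrightarrow>
     0 < lam \<and>
     (\<forall>i j. 1 \<le> i \<and> i < j \<and> j \<le> N \<longrightarrow>
        body_norm K (q i - q j) \<le> lam \<and> lam \<le> body_norm K (p i - p j))"

end

theory Submission
  imports Defs
begin

text \<open>Both volumes are compared with that of a single ball. Write \<open>d\<close> for the dimension, \<open>V\<close> for
the volume and \<open>\<rho> = lam / 2\<close>.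

A point of \<open>P\<^sup>r\<close> minus a centre \<open>p\<^sub>i\<close> lies in \<open>r K\<close>. The centres are \<open>lam\<close>-separated, so the
translates \<open>- p\<^sub>i + \<rho> int K\<close> are pairwise disjoint; let \<open>B\<close> be their union, of volume
\<open>N \<rho>\<^sup>d V(K)\<close>. Then \<open>P\<^sup>r + B \<subseteq> (r + \<rho>) K\<close>, and the Brunn--Minkowski inequality turns this inclusion
into an inequality between \<open>d\<close>-th roots of volumes: that of \<open>P\<^sup>r\<close> is at most \<open>r + \<rho> - root d N * \<rho>\<close>
times that of \<open>K\<close> (\<open>measure_ball_polyhedron_separated\<close>). Since \<open>N \<ge> 3\<^sup>d\<close>, the factor is at most
\<open>r + \<rho> - 3 \<rho> = r - lam\<close>. So \<open>V(P\<^sup>r) \<le> (r - lam)\<^sup>d V(K)\<close> and \<open>r \<ge> lam\<close>, unless \<open>P\<^sup>r\<close> has empty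
interior and hence volume zero.

In the other direction all \<open>q\<^sub>i\<close> are within distance \<open>lam\<close> of \<open>q\<^sub>1\<close>, so the triangle inequality
puts the ball of radius \<open>r - lam\<close> about \<open>q\<^sub>1\<close> into \<open>Q\<^sup>r\<close> (\<open>body_ball_subset_ball_polyhedron\<close>).
Its volume is the bound just found.

The Brunn--Minkowski inequality is proved for bounded open sets (\<open>brunn_minkowski_open\<close>) by
the method of Hadwiger and Ohmann. For two boxes it is the superadditivity of the geometric mean.
For finite unions of disjoint boxes one cuts both sets by parallel hyperplanes in the same volume
ratio, which lowers the number of boxes. Open sets are exhausted from inside by such unions.\<close>

section \<open>The Brunn--Minkowski inequality for open sets\<close>

text \<open>The inequality is kept in its \<open>d\<close>-th power: in this form the left-hand side is additive when
the two sets are cut in the same volume ratio.\<close>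

definition brunn_minkowski :: "'a::euclidean_space set \<Rightarrow> 'a set \<Rightarrow> bool" where
  "brunn_minkowski A B \<longleftrightarrow>
     (root DIM('a) (measure lebesgue A) + root DIM('a) (measure lebesgue B)) ^ DIM('a)
       \<le> measure lebesgue (A + B)"

lemma brunn_minkowski_commute:
  fixes A B :: "'a::euclidean_space set"
  shows "brunn_minkowski A B \<longleftrightarrow> brunn_minkowski B A"
  unfolding brunn_minkowski_def
  by (rule arg_cong2[where f = "\<lambda>s S. s ^ DIM('a) \<le> measure lebesgue S"]; rule add.commute)

lemma open_set_plus:
  fixes A B :: "'a::real_normed_vector set"
  assumes "open A"
  shows "open (A + B)"
proof -
  have "A + B = (\<Union>x\<in>A. \<Union>y\<in>B. {x + y})"
    by (auto simp: set_plus_def)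
  then show ?thesis
    using open_sums[of A B] assms by simp
qed

lemma lebesgue_open: "open S \<Longrightarrow> S \<in> sets lebesgue"
  by (simp add: borel_open)

lemma bounded_set_plus:
  fixes A B :: "'a::real_normed_vector set"
  assumes "bounded A" "bounded B"
  shows "bounded (A + B)"
proof -
  have "A + B = (\<Union>x\<in>A. \<Union>y\<in>B. {x + y})"
    by (auto simp: set_plus_def)
  then show ?thesis
    using bounded_sums[OF assms] by simp
qed

text \<open>Divide by the right-hand side and apply the inequality of the arithmetic and the geometric mean
to the fractions \<open>x i / (x i + y i)\<close> and \<open>y i / (x i + y i)\<close>; the two arithmetic means add up to
one.\<close>

lemma geometric_mean_superadditive:
  fixes x y :: "'i \<Rightarrow> real"
  assumes I: "finite I" "I \<noteq> {}"
    and pos: "\<And>i. i \<in> I \<Longrightarrow> 0 < x i" "\<And>i. i \<in> I \<Longrightarrow> 0 < y i"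
  shows "root (card I) (\<Prod>i\<in>I. x i) + root (card I) (\<Prod>i\<in>I. y i)
           \<le> root (card I) (\<Prod>i\<in>I. x i + y i)"
proof -
  let ?n = "card I"
  let ?z = "\<lambda>i. x i + y i"
  have n: "?n > 0"
    using I by (simp add: card_gt_0_iff)
  have z: "0 < ?z i" if "i \<in> I" for i
    using pos that by (simp add: add_pos_pos)
  have mean: "root ?n (\<Prod>i\<in>I. w i) \<le> root ?n (\<Prod>i\<in>I. ?z i) * (\<Sum>i\<in>I. w i / ?z i / ?n)"
    if w: "\<And>i. i \<in> I \<Longrightarrow> 0 < w i" for w
  proof -
    have "(\<Prod>i\<in>I. w i / ?z i) > 0"
      using w z by (intro prod_pos) simp
    then have "root ?n (\<Prod>i\<in>I. w i / ?z i) = (\<Prod>i\<in>I. w i / ?z i) powr (1 / ?n)"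
      using n by (simp add: root_powr_inverse)
    also have "\<dots> \<le> (\<Sum>i\<in>I. w i / ?z i / ?n)"
      using w z by (intro arith_geom_mean I) (simp add: less_imp_le)
    finally have "root ?n (\<Prod>i\<in>I. w i) / root ?n (\<Prod>i\<in>I. ?z i) \<le> (\<Sum>i\<in>I. w i / ?z i / ?n)"
      by (simp add: prod_dividef real_root_divide)
    moreover have "root ?n (\<Prod>i\<in>I. ?z i) > 0"
      using n z by (simp add: prod_pos)
    ultimately show ?thesis
      by (simp add: field_simps)
  qed
  have "(\<Sum>i\<in>I. x i / ?z i / ?n) + (\<Sum>i\<in>I. y i / ?z i / ?n) = (\<Sum>i\<in>I. 1 / ?n)"
    unfolding sum.distrib[symmetric]
  proof (rule sum.cong)
    fix i assume "i \<in> I"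
    then have "x i / ?z i + y i / ?z i = 1"
      using z by (simp add: add_divide_distrib[symmetric] less_imp_neq[symmetric])
    then show "x i / ?z i / ?n + y i / ?z i / ?n = 1 / ?n"
      by (metis add_divide_distrib)
  qed simp
  also have "\<dots> = 1"
    using n by simp
  finally have "(\<Sum>i\<in>I. x i / ?z i / ?n) + (\<Sum>i\<in>I. y i / ?z i / ?n) = 1" .
  then have "root ?n (\<Prod>i\<in>I. ?z i) * (\<Sum>i\<in>I. x i / ?z i / ?n)
          + root ?n (\<Prod>i\<in>I. ?z i) * (\<Sum>i\<in>I. y i / ?z i / ?n) = root ?n (\<Prod>i\<in>I. ?z i)"
    unfolding distrib_left[symmetric] by simp
  then show ?thesis
    using mean[of x, OF pos(1)] mean[of y, OF pos(2)] by linarith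
qed

text \<open>A point of the large box divides each of its edges in some ratio; the points dividing the edges
of the two summands in the same ratios lie in these and add up to it.\<close>

lemma box_plus_box:
  fixes a b c d :: "'a::euclidean_space"
  assumes "box a b \<noteq> {}" "box c d \<noteq> {}"
  shows "box (a + c) (b + d) \<subseteq> box a b + box c d"
proof
  fix z assume z: "z \<in> box (a + c) (b + d)"
  have ab: "a \<bullet> i < b \<bullet> i" and cd: "c \<bullet> i < d \<bullet> i" if "i \<in> Basis" for i
    using assms that by (auto simp: box_ne_empty)
  define t where "t i = (z \<bullet> i - (a + c) \<bullet> i) / ((b + d) \<bullet> i - (a + c) \<bullet> i)" for i
  define x where "x = (\<Sum>i\<in>Basis. (a \<bullet> i + t i * (b \<bullet> i - a \<bullet> i)) *\<^sub>R i)"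
  have t: "0 < t i \<and> t i < 1 \<and> z \<bullet> i = (a + c) \<bullet> i + t i * ((b + d) \<bullet> i - (a + c) \<bullet> i)"
    if "i \<in> Basis" for i
    using z ab[OF that] cd[OF that] that
    by (auto simp: t_def mem_box inner_add_left)
  have xi: "x \<bullet> i = a \<bullet> i + t i * (b \<bullet> i - a \<bullet> i)" if "i \<in> Basis" for i
    using that by (simp add: x_def)
  have frac: "u < u + s * (v - u) \<and> u + s * (v - u) < v" if "u < v" "0 < s" "s < 1" for u v s :: real
    
  proof
    show "u < u + s * (v - u)"
      using that by simp
    have "s * (v - u) < 1 * (v - u)"
      using that by (intro mult_strict_right_mono) auto
    then show "u + s * (v - u) < v"
      by simp
  qed
  have "x \<in> box a b"
    using frac[OF ab] t by (auto simp: mem_box xi)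
  moreover have "(z - x) \<bullet> i = c \<bullet> i + t i * (d \<bullet> i - c \<bullet> i)" if "i \<in> Basis" for i
  proof -
    have "z \<bullet> i = (a + c) \<bullet> i + t i * ((b + d) \<bullet> i - (a + c) \<bullet> i)"
      using t that by blast
    then show ?thesis
      using that by (simp add: xi inner_diff_left inner_add_left algebra_simps)
  qed
  then have "z - x \<in> box c d"
    using frac[OF cd] t by (auto simp: mem_box)
  ultimately show "z \<in> box a b + box c d"
    by (metis add.commute diff_add_cancel set_plus_intro)
qed

lemma measure_lebesgue_box:
  fixes a b :: "'a::euclidean_space"
  assumes "box a b \<noteq> {}"
  shows "measure lebesgue (box a b) = (\<Prod>i\<in>Basis. b \<bullet> i - a \<bullet> i)"
    and "0 < measure lebesgue (box a b)"
proof -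
  have lt: "a \<bullet> i < b \<bullet> i" if "i \<in> Basis" for i
    using assms that by (auto simp: box_ne_empty)
  show *: "measure lebesgue (box a b) = (\<Prod>i\<in>Basis. b \<bullet> i - a \<bullet> i)"
    using lt by (auto simp: measure_lborel_box_eq inner_diff_left less_imp_le)
  show "0 < measure lebesgue (box a b)"
    unfolding * using lt by (intro prod_pos) simp
qed

lemma brunn_minkowski_box:
  fixes a b c d :: "'a::euclidean_space"
  assumes ne: "box a b \<noteq> {}" "box c d \<noteq> {}"
  shows "brunn_minkowski (box a b) (box c d)"
proof -
  have ab: "a \<bullet> i < b \<bullet> i" and cd: "c \<bullet> i < d \<bullet> i" if "i \<in> Basis" for i
    using assms that by (auto simp: box_ne_empty)
  have ne': "box (a + c) (b + d) \<noteq> {}"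
    using ab cd by (auto simp: box_ne_empty inner_add_left intro: add_strict_mono)
  have "root DIM('a) (measure lebesgue (box a b)) + root DIM('a) (measure lebesgue (box c d))
          \<le> root DIM('a) (\<Prod>i\<in>Basis. (b \<bullet> i - a \<bullet> i) + (d \<bullet> i - c \<bullet> i))"
    unfolding measure_lebesgue_box(1)[OF ne(1)] measure_lebesgue_box(1)[OF ne(2)]
    using ab cd by (intro geometric_mean_superadditive) auto
  also have "(\<Prod>i\<in>Basis. (b \<bullet> i - a \<bullet> i) + (d \<bullet> i - c \<bullet> i)) = measure lebesgue (box (a + c) (b + d))"
    unfolding measure_lebesgue_box(1)[OF ne'] by (simp add: inner_add_left algebra_simps)
  finally have "(root DIM('a) (measure lebesgue (box a b)) + root DIM('a) (measure lebesgue (box c d))) ^ DIM('a)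
      \<le> root DIM('a) (measure lebesgue (box (a + c) (b + d))) ^ DIM('a)"
    by (intro power_mono) auto
  also have "\<dots> = measure lebesgue (box (a + c) (b + d))"
    by (simp add: real_root_pow_pos2)
  also have "\<dots> \<le> measure lebesgue (box a b + box c d)"
    using box_plus_box[OF ne]
    by (intro measure_mono_fmeasurable lmeasurable_open bounded_set_plus open_set_plus) auto
  finally show ?thesis
    unfolding brunn_minkowski_def .
qed

definition disjoint_boxes :: "'a::euclidean_space set set \<Rightarrow> bool" where
  "disjoint_boxes D \<longleftrightarrow> finite D \<and> disjoint D \<and> (\<forall>S\<in>D. S \<noteq> {} \<and> (\<exists>a b. S = box a b))"

lemma disjoint_boxesD:
  assumes "disjoint_boxes D"
  shows "finite D"
    and "\<And>S T. S \<in> D \<Longrightarrow> T \<in> D \<Longrightarrow> S \<noteq> T \<Longrightarrow> S \<inter> T = {}"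
    and "\<And>S thesis. S \<in> D \<Longrightarrow> (\<And>a b. S = box a b \<Longrightarrow> box a b \<noteq> {} \<Longrightarrow> thesis) \<Longrightarrow> thesis"
proof -
  note D = assms[unfolded disjoint_boxes_def]
  have fin: "finite D" 
    by (rule D[THEN conjunct1])
  have disj: "disjoint D" 
    by (rule D[THEN conjunct2, THEN conjunct1])
  have box: "\<forall>S\<in>D. S \<noteq> {} \<and> (\<exists>a b. S = box a b)"
    by (rule D[THEN conjunct2, THEN conjunct2])
  show "finite D"
    by (rule fin)
  show "S \<inter> T = {}" if "S \<in> D" "T \<in> D" "S \<noteq> T" for S T
    using pairwiseD[OF disj that] by (simp add: disjnt_def)
  show thesis if "S \<in> D" and thesis: "\<And>a b. S = box a b \<Longrightarrow> box a b \<noteq> {} \<Longrightarrow> thesis" for S thesis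
  proof -
    from box \<open>S \<in> D\<close> have "S \<noteq> {} \<and> (\<exists>a b. S = box a b)"
      by (rule bspec)
    then obtain a b where "S \<noteq> {}" "S = box a b"
      by (elim conjE exE)
    then show thesis
      by (intro thesis[of a b]) simp_all
  qed
qed

lemma disjoint_boxes_Union:
  assumes "disjoint_boxes D"
  shows "open (\<Union>D)" "bounded (\<Union>D)" "\<Union>D \<in> lmeasurable"
    and "D \<noteq> {} \<Longrightarrow> 0 < measure lebesgue (\<Union>D)"
proof -
  note box = disjoint_boxesD(3)[OF assms]
  show op: "open (\<Union>D)"
  proof (rule open_Union, rule ballI)
    fix S assume "S \<in> D"
    then show "open S"
      by (rule box) (simp add: open_box)
  qed
  show bd: "bounded (\<Union>D)"
  proof (rule bounded_Union[OF disjoint_boxesD(1)[OF assms]], rule ballI)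
    fix S assume "S \<in> D"
    then show "bounded S"
      by (rule box) simp
  qed
  show m: "\<Union>D \<in> lmeasurable"
    using op bd by (simp add: lmeasurable_open)
  show "0 < measure lebesgue (\<Union>D)" if "D \<noteq> {}"
  proof -
    from that obtain S where "S \<in> D"
      by blast
    obtain a b where S: "S = box a b" "box a b \<noteq> {}"
      using \<open>S \<in> D\<close> by (rule box)
    have "0 < measure lebesgue S"
      unfolding S(1) by (rule measure_lebesgue_box(2)[OF S(2)])
    also have "\<dots> \<le> measure lebesgue (\<Union>D)"
      using \<open>S \<in> D\<close> S(1) by (intro measure_mono_fmeasurable m) auto
    finally show ?thesis .
  qed
qed

definition cut_boxes :: "'a set \<Rightarrow> 'a set set \<Rightarrow> 'a set set" where
  "cut_boxes H D = (\<lambda>S. S \<inter> H) ` {S \<in> D. S \<inter> H \<noteq> {}}"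

lemma Union_cut_boxes: "\<Union>(cut_boxes H D) = \<Union>D \<inter> H"
  by (auto simp: cut_boxes_def)

lemma card_cut_boxes_le:
  assumes "finite D"
  shows "card (cut_boxes H D) \<le> card D"
proof -
  have "card (cut_boxes H D) \<le> card {S \<in> D. S \<inter> H \<noteq> {}}"
    unfolding cut_boxes_def using assms by (intro card_image_le) simp
  also have "\<dots> \<le> card D"
    using assms by (intro card_mono) auto
  finally show ?thesis .
qed

text \<open>This is where the induction on the number of boxes gains: a box on the far side of the
hyperplane disappears.\<close>

lemma card_cut_boxes_less:
  assumes "finite D" "S \<in> D" "S \<inter> H = {}"
  shows "card (cut_boxes H D) < card D"
proof -
  have "card (cut_boxes H D) \<le> card {S \<in> D. S \<inter> H \<noteq> {}}"
    unfolding cut_boxes_def using assms by (intro card_image_le) simp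
  also have "\<dots> < card D"
    using assms by (intro psubset_card_mono) auto
  finally show ?thesis .
qed

lemma disjoint_boxes_cut:
  assumes D: "disjoint_boxes D" and H: "\<And>a b. \<exists>a' b'. box a b \<inter> H = box a' b'"
  shows "disjoint_boxes (cut_boxes H D)"
  unfolding disjoint_boxes_def
proof (intro conjI ballI pairwiseI)
  show "finite (cut_boxes H D)"
    using disjoint_boxesD(1)[OF D] by (simp add: cut_boxes_def)
  fix S assume "S \<in> cut_boxes H D"
  then obtain S' where S': "S' \<in> D" "S = S' \<inter> H" and "S \<noteq> {}"
    by (auto simp: cut_boxes_def)
  show "S \<noteq> {}" by fact
  obtain a b where "S' = box a b"
    using S'(1) by (rule disjoint_boxesD(3)[OF D])
  then show "\<exists>a b. S = box a b"
    using H S'(2) by simp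
  fix T assume "T \<in> cut_boxes H D" and "S \<noteq> T"
  then obtain T' where T': "T' \<in> D" "T = T' \<inter> H"
    by (auto simp: cut_boxes_def)
  then have "S' \<inter> T' = {}"
    using S' \<open>S \<noteq> T\<close> by (intro disjoint_boxesD(2)[OF D]) auto
  then show "disjnt S T"
    using S' T' by (auto simp: disjnt_def)
qed

lemma box_Int_halfspace:
  fixes a b :: "'a::euclidean_space"
  assumes k: "k \<in> Basis"
  shows "\<exists>a' b'. box a b \<inter> {x. x \<bullet> k < c} = box a' b'"
    and "\<exists>a' b'. box a b \<inter> {x. c < x \<bullet> k} = box a' b'"
proof -
  have "box a b \<inter> {x. x \<bullet> k < c}
          = box a (\<Sum>i\<in>Basis. (if i = k then min (b \<bullet> k) c else b \<bullet> i) *\<^sub>R i)"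
    using k by (intro set_eqI) (auto simp: mem_box)
  then show "\<exists>a' b'. box a b \<inter> {x. x \<bullet> k < c} = box a' b'"
    by blast
  have "box a b \<inter> {x. c < x \<bullet> k}
          = box (\<Sum>i\<in>Basis. (if i = k then max (a \<bullet> k) c else a \<bullet> i) *\<^sub>R i) b"
    using k by (intro set_eqI) (auto simp: mem_box)
  then show "\<exists>a' b'. box a b \<inter> {x. c < x \<bullet> k} = box a' b'"
    by blast
qed

text \<open>The hyperplane to cut along. Disjoint boxes have disjoint projections to some coordinate axis.\<close>

lemma disjoint_boxes_separated:
  assumes D: "disjoint_boxes D" and ST: "S \<in> D" "T \<in> D" "S \<noteq> T"
  obtains k c where "k \<in> Basis"
    and "S \<subseteq> {x. x \<bullet> k < c} \<and> T \<subseteq> {x. c < x \<bullet> k} \<or> T \<subseteq> {x. x \<bullet> k < c} \<and> S \<subseteq> {x. c < x \<bullet> k}"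
proof -
  obtain a b where S: "S = box a b" "box a b \<noteq> {}"
    using ST(1) by (rule disjoint_boxesD(3)[OF D])
  obtain c d where T: "T = box c d" "box c d \<noteq> {}"
    using ST(2) by (rule disjoint_boxesD(3)[OF D])
  have "box a b \<inter> box c d = {}"
    using disjoint_boxesD(2)[OF D ST] S T by simp
  then obtain k where k: "k \<in> Basis" and
    "b \<bullet> k \<le> a \<bullet> k \<or> d \<bullet> k \<le> c \<bullet> k \<or> b \<bullet> k \<le> c \<bullet> k \<or> d \<bullet> k \<le> a \<bullet> k"
    by (auto simp: disjoint_interval)
  moreover have "a \<bullet> k < b \<bullet> k" "c \<bullet> k < d \<bullet> k"
    using k S T by (auto simp: box_ne_empty)
  ultimately consider "b \<bullet> k \<le> c \<bullet> k" | "d \<bullet> k \<le> a \<bullet> k"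
    by linarith
  then show ?thesis
  proof cases
    case 1
    then show ?thesis
      using k by (intro that[of k "b \<bullet> k"]) (force simp: S T mem_box)+
  next
    case 2
    then show ?thesis
      using k by (intro that[of k "d \<bullet> k"]) (force simp: S T mem_box)+
  qed
qed

lemma negligible_coordinate_hyperplane:
  fixes k :: "'a::euclidean_space"
  assumes "k \<in> Basis"
  shows "negligible {x. x \<bullet> k = c}"
proof -
  have "negligible {x. k \<bullet> x = c}"
    using assms by (intro negligible_hyperplane) auto
  then show ?thesis
    by (simp only: inner_commute[of k])
qed

lemma measure_cut:
  fixes A :: "'a::euclidean_space set"
  assumes A: "A \<in> lmeasurable" and k: "k \<in> Basis"
  shows "measure lebesgue A
           = measure lebesgue (A \<inter> {x. x \<bullet> k < c}) + measure lebesgue (A \<inter> {x. c < x \<bullet> k})"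
proof -
  have m: "A \<inter> {x. x \<bullet> k < c} \<in> lmeasurable" "A \<inter> {x. c < x \<bullet> k} \<in> lmeasurable"
    using A by (auto intro!: fmeasurable_Int_fmeasurable borel_open
        open_halfspace_component_lt open_halfspace_component_gt)
  have "negligible ((A \<inter> {x. x \<bullet> k < c} \<union> A \<inter> {x. c < x \<bullet> k} - A)
      \<union> (A - (A \<inter> {x. x \<bullet> k < c} \<union> A \<inter> {x. c < x \<bullet> k})))"
    using negligible_coordinate_hyperplane[OF k, of c] by (rule negligible_subset) auto
  then have "measure lebesgue A
      = measure lebesgue ((A \<inter> {x. x \<bullet> k < c}) \<union> (A \<inter> {x. c < x \<bullet> k}))"
    by (intro measure_negligible_symdiff fmeasurable.Un m)
  also have "\<dots> = measure lebesgue (A \<inter> {x. x \<bullet> k < c}) + measure lebesgue (A \<inter> {x. c < x \<bullet> k})"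
    using measure_Un2[OF m] by (simp add: Diff_triv disjoint_iff)
  finally show ?thesis .
qed

text \<open>Moving the hyperplane changes the indicator function continuously off the hyperplane itself,
which is a null set, so dominated convergence applies.\<close>

lemma continuous_measure_halfspace:
  fixes A :: "'a::euclidean_space set"
  assumes A: "A \<in> lmeasurable" and k: "k \<in> Basis"
  shows "continuous_on UNIV (\<lambda>c. measure lebesgue (A \<inter> {x. x \<bullet> k < c}))"
proof (clarsimp simp: continuous_on_sequentially comp_def)
  fix u :: "nat \<Rightarrow> real" and c assume u: "u \<longlonglongrightarrow> c"
  let ?H = "\<lambda>c. A \<inter> {x. x \<bullet> k < c}"
  have m: "?H c \<in> lmeasurable" for c
    using A by (auto intro!: fmeasurable_Int_fmeasurable borel_open
        open_halfspace_component_lt)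
  have lim: "(\<lambda>n. indicat_real (?H (u n)) x) \<longlonglongrightarrow> indicat_real (?H c) x" if "x \<bullet> k \<noteq> c" for x
  proof (rule tendsto_eventually)
    from that consider "x \<bullet> k < c" | "c < x \<bullet> k" by linarith
    then show "\<forall>\<^sub>F n in sequentially. indicat_real (?H (u n)) x = indicat_real (?H c) x"
    proof cases
      case 1
      then have "\<forall>\<^sub>F n in sequentially. x \<bullet> k < u n"
        using u order_tendstoD(1) by blast
      then show ?thesis
        by eventually_elim (use 1 in \<open>auto simp: indicator_def\<close>)
    next
      case 2
      then have "\<forall>\<^sub>F n in sequentially. u n < x \<bullet> k"
        using u order_tendstoD(2) by blast
      then show ?thesis
        by eventually_elim (use 2 in \<open>auto simp: indicator_def\<close>)
    qed
  qed
  have meas: "indicat_real (?H c) \<in> borel_measurable lebesgue" for c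
    using m by (intro borel_measurable_indicator) (auto simp: fmeasurable_def)
  have "AE x in lebesgue. x \<bullet> k \<noteq> c"
    using negligible_coordinate_hyperplane[OF k, of c]
    by (intro AE_I'[of "{x. x \<bullet> k = c}"]) (auto simp: negligible_iff_null_sets)
  then have "AE x in lebesgue. (\<lambda>n. indicat_real (?H (u n)) x) \<longlonglongrightarrow> indicat_real (?H c) x"
    by eventually_elim (rule lim)
  then have "(\<lambda>n. \<integral>x. indicat_real (?H (u n)) x \<partial>lebesgue) \<longlonglongrightarrow> (\<integral>x. indicat_real (?H c) x \<partial>lebesgue)"
    using A meas
    by (intro integral_dominated_convergence[where w = "indicat_real A"])
       (auto simp: fmeasurable_def split: split_indicator)
  then show "(\<lambda>n. measure lebesgue (?H (u n))) \<longlonglongrightarrow> measure lebesgue (?H c)"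
    by simp
qed

lemma measure_halfspace_attains:
  fixes A :: "'a::euclidean_space set"
  assumes A: "bounded A" "A \<in> lmeasurable" and k: "k \<in> Basis"
    and t: "0 \<le> t" "t \<le> measure lebesgue A"
  obtains c where "measure lebesgue (A \<inter> {x. x \<bullet> k < c}) = t"
proof -
  obtain M where M: "0 < M" "\<And>x. x \<in> A \<Longrightarrow> norm x \<le> M"
    using A(1) by (auto simp: bounded_pos)
  have coord: "\<bar>x \<bullet> k\<bar> \<le> M" if "x \<in> A" for x
    using Basis_le_norm[OF k, of x] M(2)[OF that] by linarith
  have "A \<inter> {x. x \<bullet> k < - M} = {}" "A \<inter> {x. x \<bullet> k < M + 1} = A"
    using coord by force+
  then have "measure lebesgue (A \<inter> {x. x \<bullet> k < - M}) \<le> t"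
      "t \<le> measure lebesgue (A \<inter> {x. x \<bullet> k < M + 1})"
    using t by simp_all
  then obtain c where "measure lebesgue (A \<inter> {x. x \<bullet> k < c}) = t"
    using IVT'[of "\<lambda>c. measure lebesgue (A \<inter> {x. x \<bullet> k < c})" "- M" t "M + 1"] M(1)
      continuous_on_subset[OF continuous_measure_halfspace[OF A(2) k]]
    by auto
  then show thesis
    by (rule that)
qed

text \<open>Points below the two hyperplanes add up to points below the hyperplane at \<open>c + c'\<close>, and likewise
above, so the sums of the parts do not overlap and their volumes add. As both sets are cut in the
ratio \<open>t\<close>, the powers of the sums of roots for the parts are the fractions \<open>t\<close> and \<open>1 - t\<close> of that
for the whole sets.\<close>

lemma brunn_minkowski_cut:
  fixes A B :: "'a::euclidean_space set"
  assumes A: "open A" "bounded A" and B: "open B" "bounded B" and k: "k \<in> Basis"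
    and A1: "measure lebesgue (A \<inter> {x. x \<bullet> k < c}) = t * measure lebesgue A"
    and B1: "measure lebesgue (B \<inter> {x. x \<bullet> k < c'}) = t * measure lebesgue B"
    and t: "0 \<le> t" "t \<le> 1"
    and lower: "brunn_minkowski (A \<inter> {x. x \<bullet> k < c}) (B \<inter> {x. x \<bullet> k < c'})"
    and upper: "brunn_minkowski (A \<inter> {x. c < x \<bullet> k}) (B \<inter> {x. c' < x \<bullet> k})"
  shows "brunn_minkowski A B"
proof -
  let ?n = "DIM('a)" and ?\<mu> = "measure (lebesgue :: 'a measure)"
  let ?s = "root ?n (?\<mu> A) + root ?n (?\<mu> B)"
  have A2: "?\<mu> (A \<inter> {x. c < x \<bullet> k}) = (1 - t) * ?\<mu> A"
    using measure_cut[OF lmeasurable_open[OF A(2,1)] k, of c] A1 by (simp add: algebra_simps)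
  have B2: "?\<mu> (B \<inter> {x. c' < x \<bullet> k}) = (1 - t) * ?\<mu> B"
    using measure_cut[OF lmeasurable_open[OF B(2,1)] k, of c'] B1 by (simp add: algebra_simps)
  have m: "A + B \<in> lmeasurable"
    using A B by (intro lmeasurable_open open_set_plus bounded_set_plus)
  have m': "(A + B) \<inter> {x. x \<bullet> k < c + c'} \<in> lmeasurable" "(A + B) \<inter> {x. c + c' < x \<bullet> k} \<in> lmeasurable"
    using m by (auto intro!: fmeasurable_Int_fmeasurable borel_open
        open_halfspace_component_lt open_halfspace_component_gt)
  have scale: "(root ?n (u * ?\<mu> A) + root ?n (u * ?\<mu> B)) ^ ?n = u * ?s ^ ?n" if "0 \<le> u" for u
  proof -
    have "root ?n (u * ?\<mu> A) + root ?n (u * ?\<mu> B) = root ?n u * ?s"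
      by (simp add: real_root_mult algebra_simps)
    then show ?thesis
      using that by (simp add: power_mult_distrib)
  qed
  have op: "open (A \<inter> {x. x \<bullet> k < c})" "open (A \<inter> {x. c < x \<bullet> k})"
    using A by (auto intro: open_halfspace_component_lt open_halfspace_component_gt)
  have "t * ?s ^ ?n \<le> ?\<mu> ((A \<inter> {x. x \<bullet> k < c}) + (B \<inter> {x. x \<bullet> k < c'}))"
    using lower scale[OF t(1)] unfolding brunn_minkowski_def A1 B1 by simp
  also have "\<dots> \<le> ?\<mu> ((A + B) \<inter> {x. x \<bullet> k < c + c'})"
    using op(1)
    by (intro measure_mono_fmeasurable m' lebesgue_open open_set_plus)
      (auto simp: set_plus_def inner_add_left)
  finally have 1: "t * ?s ^ ?n \<le> ?\<mu> ((A + B) \<inter> {x. x \<bullet> k < c + c'})" .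
  have "(1 - t) * ?s ^ ?n \<le> ?\<mu> ((A \<inter> {x. c < x \<bullet> k}) + (B \<inter> {x. c' < x \<bullet> k}))"
    using upper scale[of "1 - t"] t(2) unfolding brunn_minkowski_def A2 B2 by simp
  also have "\<dots> \<le> ?\<mu> ((A + B) \<inter> {x. c + c' < x \<bullet> k})"
    using op(2)
    by (intro measure_mono_fmeasurable m' lebesgue_open open_set_plus)
      (auto simp: set_plus_def inner_add_left)
  finally have 2: "(1 - t) * ?s ^ ?n \<le> ?\<mu> ((A + B) \<inter> {x. c + c' < x \<bullet> k})" .
  have "?s ^ ?n = t * ?s ^ ?n + (1 - t) * ?s ^ ?n"
    by (simp add: algebra_simps)
  also have "\<dots> \<le> ?\<mu> (A + B)"
    using 1 2 measure_cut[OF m k, of "c + c'"] by linarith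
  finally show ?thesis
    unfolding brunn_minkowski_def .
qed

text \<open>Cut one family between two of its boxes, so that both parts have fewer boxes, and the other
family in the same volume ratio, where the number of boxes cannot grow. This lowers the total number
until a single box is left on each side.\<close>

lemma brunn_minkowski_disjoint_boxes:
  fixes D E :: "'a::euclidean_space set set"
  assumes "disjoint_boxes D" "D \<noteq> {}" "disjoint_boxes E" "E \<noteq> {}"
  shows "brunn_minkowski (\<Union>D) (\<Union>E)"
  using assms
proof (induction "card D + card E" arbitrary: D E rule: less_induct)
  case less
  have cut: "brunn_minkowski (\<Union>F) (\<Union>G)"
    if FG: "card F + card G = card D + card E"
      and F: "disjoint_boxes F" and G: "disjoint_boxes G" "G \<noteq> {}"
      and two: "\<not> card F \<le> Suc 0"
    for F G :: "'a set set"
  proof -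
    let ?\<mu> = "measure (lebesgue :: 'a measure)"
    note finF = disjoint_boxesD(1)[OF F] and finG = disjoint_boxesD(1)[OF G(1)]
    obtain S T where ST: "S \<in> F" "T \<in> F" "S \<noteq> T"
      using two card_le_Suc0_iff_eq[OF finF] by auto
    obtain k c where k: "k \<in> Basis"
      and "S \<subseteq> {x. x \<bullet> k < c} \<and> T \<subseteq> {x. c < x \<bullet> k} \<or> T \<subseteq> {x. x \<bullet> k < c} \<and> S \<subseteq> {x. c < x \<bullet> k}"
      using disjoint_boxes_separated[OF F ST] .
    then obtain S T where ST: "S \<in> F" "T \<in> F"
      and S: "S \<subseteq> {x. x \<bullet> k < c}" and T: "T \<subseteq> {x. c < x \<bullet> k}"
      using ST by blast
    have ne: "S \<noteq> {}" "T \<noteq> {}"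
      using disjoint_boxesD(3)[OF F] ST by metis+
    define F1 where "F1 = cut_boxes {x. x \<bullet> k < c} F"
    define F2 where "F2 = cut_boxes {x. c < x \<bullet> k} F"
    have UF: "\<Union>F1 = \<Union>F \<inter> {x. x \<bullet> k < c}" "\<Union>F2 = \<Union>F \<inter> {x. c < x \<bullet> k}"
      by (simp_all add: F1_def F2_def Union_cut_boxes)
    have F12: "disjoint_boxes F1" "disjoint_boxes F2"
      unfolding F1_def F2_def using box_Int_halfspace[OF k] by (intro disjoint_boxes_cut F; blast)+
    have neF: "F1 \<noteq> {}" "F2 \<noteq> {}"
      using ST S T ne UF by blast+
    have less: "card F1 < card F" "card F2 < card F"
      unfolding F1_def F2_def
      using ST S T by (force intro!: card_cut_boxes_less[OF finF])+
    have pos: "0 < ?\<mu> (\<Union>F1)" "0 < ?\<mu> (\<Union>F2)" "0 < ?\<mu> (\<Union>G)"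
      using disjoint_boxes_Union(4) F12 neF G by blast+
    have split: "?\<mu> (\<Union>F) = ?\<mu> (\<Union>F1) + ?\<mu> (\<Union>F2)"
      unfolding UF by (rule measure_cut[OF disjoint_boxes_Union(3)[OF F] k])
    define t where "t = ?\<mu> (\<Union>F1) / ?\<mu> (\<Union>F)"
    have t: "0 < t" "t < 1" and F1: "?\<mu> (\<Union>F1) = t * ?\<mu> (\<Union>F)"
      using pos split by (simp_all add: t_def)
    have "0 \<le> t * ?\<mu> (\<Union>G)" "t * ?\<mu> (\<Union>G) \<le> ?\<mu> (\<Union>G)"
      using t pos(3) by (simp_all add: mult_left_le_one_le)
    then obtain c' where c': "?\<mu> (\<Union>G \<inter> {x. x \<bullet> k < c'}) = t * ?\<mu> (\<Union>G)"
      using measure_halfspace_attains[OF disjoint_boxes_Union(2,3)[OF G(1)] k] by blast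
    define G1 where "G1 = cut_boxes {x. x \<bullet> k < c'} G"
    define G2 where "G2 = cut_boxes {x. c' < x \<bullet> k} G"
    have UG: "\<Union>G1 = \<Union>G \<inter> {x. x \<bullet> k < c'}" "\<Union>G2 = \<Union>G \<inter> {x. c' < x \<bullet> k}"
      by (simp_all add: G1_def G2_def Union_cut_boxes)
    have G12: "disjoint_boxes G1" "disjoint_boxes G2"
      unfolding G1_def G2_def using box_Int_halfspace[OF k] by (intro disjoint_boxes_cut G; blast)+
    have le: "card G1 \<le> card G" "card G2 \<le> card G"
      unfolding G1_def G2_def by (intro card_cut_boxes_le finG)+
    have "?\<mu> (\<Union>G) = ?\<mu> (\<Union>G1) + ?\<mu> (\<Union>G2)"
      unfolding UG by (rule measure_cut[OF disjoint_boxes_Union(3)[OF G(1)] k])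
    moreover have "0 < t * ?\<mu> (\<Union>G)" "t * ?\<mu> (\<Union>G) < 1 * ?\<mu> (\<Union>G)"
      using t pos(3) by (simp, intro mult_strict_right_mono) auto
    ultimately have "0 < ?\<mu> (\<Union>G1)" "0 < ?\<mu> (\<Union>G2)"
      using c' by (simp_all add: UG(1))
    then have neG: "G1 \<noteq> {}" "G2 \<noteq> {}"
      by auto
    have "brunn_minkowski (\<Union>F1) (\<Union>G1)" "brunn_minkowski (\<Union>F2) (\<Union>G2)"
      using less le FG F12 G12 neF neG by (intro less.hyps; simp)+
    then show ?thesis
      using brunn_minkowski_cut[OF disjoint_boxes_Union(1,2)[OF F] disjoint_boxes_Union(1,2)[OF G(1)] k
          F1[unfolded UF] c'] t
      by (simp add: UF UG)
  qed
  consider "\<not> card D \<le> Suc 0" | "\<not> card E \<le> Suc 0" | "card D \<le> Suc 0" "card E \<le> Suc 0"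
    by blast
  then show ?case
  proof cases
    case 1
    then show ?thesis
      using less.prems by (intro cut) simp_all
  next
    case 2
    then show ?thesis
      using less.prems by (subst brunn_minkowski_commute, intro cut) simp_all
  next
    case 3
    note fin = disjoint_boxesD(1)[OF less.prems(1)] disjoint_boxesD(1)[OF less.prems(3)]
    have "card D \<noteq> 0" "card E \<noteq> 0"
      using fin less.prems by simp_all
    then obtain S T where ST: "D = {S}" "E = {T}"
      using 3 by (metis One_nat_def card_1_singletonE le_SucE le_zero_eq)
    obtain a b where "S = box a b" "box a b \<noteq> {}"
      by (rule disjoint_boxesD(3)[OF less.prems(1), of S]) (simp_all add: ST)
    moreover obtain c d where "T = box c d" "box c d \<noteq> {}"
      by (rule disjoint_boxesD(3)[OF less.prems(3), of T]) (simp_all add: ST)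
    ultimately show ?thesis
      using brunn_minkowski_box by (simp add: ST)
  qed
qed

text \<open>A bounded open set is a countable union of closed boxes without common interior points. Finitely
many of them carry almost all of the volume, and passing to the interiors loses only their
boundaries.\<close>

lemma open_inner_disjoint_boxes:
  fixes A :: "'a::euclidean_space set"
  assumes A: "open A" "bounded A" "A \<noteq> {}" and e: "0 < e"
  obtains D where "disjoint_boxes D" "\<Union>D \<subseteq> A" "measure lebesgue A - e < measure lebesgue (\<Union>D)"
proof -
  obtain a where a: "A \<subseteq> box (- a) a"
    using bounded_subset_box_symmetric[OF A(2)] by blast
  \<comment> \<open>This gauge forces every box of the covering to stay inside \<open>A\<close>.\<close>
  have "gauge (\<lambda>x. if x \<in> A then A else UNIV)"
    using A(1) by (auto simp: gauge_def)
  moreover have "A \<subseteq> cbox (- a) a" "box (- a) a \<noteq> {}"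
    using a A(3) box_subset_cbox by blast+
  ultimately obtain C where C: "countable C" and "\<Union>C \<subseteq> cbox (- a) a"
    and box: "\<And>S. S \<in> C \<Longrightarrow> interior S \<noteq> {} \<and> (\<exists>c d. S = cbox c d)"
    and disj: "pairwise (\<lambda>S T. interior S \<inter> interior T = {}) C"
    and inA: "\<And>S. S \<in> C \<Longrightarrow> \<exists>x \<in> A \<inter> S. S \<subseteq> (if x \<in> A then A else UNIV)"
    and "\<And>u v. cbox u v \<in> C \<Longrightarrow> \<exists>n. \<forall>i\<in>Basis. v \<bullet> i - u \<bullet> i = (a \<bullet> i - (- a) \<bullet> i) / 2 ^ n"
    and cover: "A \<subseteq> \<Union>C"
    using covering_lemma[of A "- a" a "\<lambda>x. if x \<in> A then A else UNIV"] by metis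
  have sub: "S \<subseteq> A" if "S \<in> C" for S
    using inA[OF that] by auto
  then have UC: "\<Union>C = A"
    using cover by blast
  have mS: "S \<in> lmeasurable" if "S \<in> C" for S
    using box[OF that] by auto
  have mA: "A \<in> lmeasurable"
    using A by (simp add: lmeasurable_open)
  have "measure lebesgue (\<Union>C') \<le> measure lebesgue A" if "C' \<subseteq> C" "finite C'" for C'
    using that sub mS by (intro measure_mono_fmeasurable mA fmeasurableD fmeasurable.finite_Union) auto
  then obtain C' where C': "C' \<subseteq> C" "finite C'"
    and approx: "measure lebesgue (\<Union>C) - e < measure lebesgue (\<Union>C')"
    using measure_countable_Union_approachable[OF C e mS] by metis
  let ?D = "interior ` C'"
  have "disjoint_boxes ?D"
    unfolding disjoint_boxes_def
  proof (intro conjI ballI pairwiseI)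
    show "finite ?D"
      using C'(2) by simp
    fix S assume "S \<in> ?D"
    then obtain S' where S': "S' \<in> C'" "S = interior S'"
      by blast
    then show "S \<noteq> {}" "\<exists>c d. S = box c d"
      using box[of S'] C'(1) interior_cbox by (blast, metis subsetD)
    fix T assume "T \<in> ?D" and "S \<noteq> T"
    then obtain T' where T': "T' \<in> C'" "T = interior T'"
      by blast
    then have "S' \<noteq> T'"
      using S' \<open>S \<noteq> T\<close> by blast
    then show "disjnt S T"
      unfolding disjnt_def S'(2) T'(2) using S'(1) T'(1) C'(1) by (intro pairwiseD[OF disj]) auto
  qed
  moreover have "\<Union>?D \<subseteq> A"
    using C'(1) sub interior_subset by blast
  moreover have "measure lebesgue (\<Union>?D) = measure lebesgue (\<Union>C')"
  proof (rule measure_negligible_symdiff)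
    show "\<Union>C' \<in> lmeasurable"
      using C' mS by (intro fmeasurable.finite_Union) auto
    have "negligible (frontier S)" if S: "S \<in> C'" for S
    proof -
      obtain c d where "S = cbox c d"
        using box S C'(1) by blast
      then show ?thesis
        by (simp add: negligible_convex_frontier)
    qed
    then have "negligible (\<Union>(frontier ` C'))"
      using C'(2) by (intro negligible_Union) auto
    then show "negligible (\<Union>C' - \<Union>?D \<union> (\<Union>?D - \<Union>C'))"
      by (rule negligible_subset) (auto simp: frontier_def dest: subsetD[OF closure_subset] subsetD[OF interior_subset])
  qed
  ultimately show thesis
    using approx UC that by simp
qed

lemma brunn_minkowski_open:
  fixes A B :: "'a::euclidean_space set"
  assumes A: "open A" "bounded A" "A \<noteq> {}" and B: "open B" "bounded B" "B \<noteq> {}"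
  shows "root DIM('a) (measure lebesgue A) + root DIM('a) (measure lebesgue B)
           \<le> root DIM('a) (measure lebesgue (A + B))"
proof -
  let ?\<mu> = "measure (lebesgue :: 'a measure)" and ?n = "DIM('a)"
  \<comment> \<open>The defect is a proper fraction of the volume, so that no approximating family is empty.\<close>
  have approx: "\<exists>f. \<forall>n. disjoint_boxes (f n) \<and> f n \<noteq> {} \<and> \<Union>(f n) \<subseteq> S \<and>
      ?\<mu> S - ?\<mu> S / real (n + 2) \<le> ?\<mu> (\<Union>(f n))"
    if S: "open S" "bounded S" "S \<noteq> {}" for S :: "'a set"
  proof (intro choice allI)
    fix n
    have "0 < ?\<mu> S"
      using open_not_negligible[OF S(1,3)] lmeasurable_open[OF S(2,1)]
      by (simp add: negligible_iff_measure zero_less_measure_iff)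
    then have e: "0 < ?\<mu> S / real (n + 2)"
      by simp
    obtain D where D: "disjoint_boxes D" "\<Union>D \<subseteq> S"
      "?\<mu> S - ?\<mu> S / real (n + 2) < ?\<mu> (\<Union>D)"
      using open_inner_disjoint_boxes[OF S e] .
    have "?\<mu> S / real (n + 2) \<le> ?\<mu> S"
      using \<open>0 < ?\<mu> S\<close> by (simp add: field_simps)
    then have "0 < ?\<mu> (\<Union>D)"
      using D(3) by linarith
    then have "D \<noteq> {}"
      by auto
    then show "\<exists>D. disjoint_boxes D \<and> D \<noteq> {} \<and> \<Union>D \<subseteq> S \<and> ?\<mu> S - ?\<mu> S / real (n + 2) \<le> ?\<mu> (\<Union>D)"
      using D by (meson less_imp_le)
  qed
  obtain F where F: "\<And>n. disjoint_boxes (F n)" "\<And>n. F n \<noteq> {}" "\<And>n. \<Union>(F n) \<subseteq> A"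
      "\<And>n. ?\<mu> A - ?\<mu> A / real (n + 2) \<le> ?\<mu> (\<Union>(F n))"
    using approx[OF A] by blast
  obtain G where G: "\<And>n. disjoint_boxes (G n)" "\<And>n. G n \<noteq> {}" "\<And>n. \<Union>(G n) \<subseteq> B"
      "\<And>n. ?\<mu> B - ?\<mu> B / real (n + 2) \<le> ?\<mu> (\<Union>(G n))"
    using approx[OF B] by blast
  have to: "(\<lambda>n. ?\<mu> (\<Union>(f n))) \<longlonglongrightarrow> ?\<mu> S"
    if f: "\<And>n. disjoint_boxes (f n)" "\<And>n. \<Union>(f n) \<subseteq> S"
      "\<And>n. ?\<mu> S - ?\<mu> S / real (n + 2) \<le> ?\<mu> (\<Union>(f n))"
      and S: "open S" "bounded S" for f :: "nat \<Rightarrow> 'a set set" and S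
  proof (rule tendsto_sandwich[OF always_eventually always_eventually])
    show "\<forall>n. ?\<mu> S - ?\<mu> S / real (n + 2) \<le> ?\<mu> (\<Union>(f n))"
      using f(3) by blast
    show "\<forall>n. ?\<mu> (\<Union>(f n)) \<le> ?\<mu> S"
      using f(2) disjoint_boxes_Union(3)[OF f(1)]
      by (intro allI measure_mono_fmeasurable fmeasurableD lmeasurable_open[OF S(2,1)])
    have "(\<lambda>n. ?\<mu> S / real (n + 2)) \<longlonglongrightarrow> 0"
      using LIMSEQ_ignore_initial_segment[OF lim_const_over_n[of "?\<mu> S"], of 2] by simp
    then show "(\<lambda>n. ?\<mu> S - ?\<mu> S / real (n + 2)) \<longlonglongrightarrow> ?\<mu> S"
      using tendsto_diff[OF tendsto_const] by fastforce
  qed simp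
  have "(root ?n (?\<mu> A) + root ?n (?\<mu> B)) ^ ?n \<le> ?\<mu> (A + B)"
  proof (rule LIMSEQ_le_const2)
    show "(\<lambda>n. (root ?n (?\<mu> (\<Union>(F n))) + root ?n (?\<mu> (\<Union>(G n)))) ^ ?n)
            \<longlonglongrightarrow> (root ?n (?\<mu> A) + root ?n (?\<mu> B)) ^ ?n"
      by (intro tendsto_intros to F G A B)
    have "(root ?n (?\<mu> (\<Union>(F n))) + root ?n (?\<mu> (\<Union>(G n)))) ^ ?n \<le> ?\<mu> (A + B)" for n
    proof -
      have "(root ?n (?\<mu> (\<Union>(F n))) + root ?n (?\<mu> (\<Union>(G n)))) ^ ?n \<le> ?\<mu> (\<Union>(F n) + \<Union>(G n))"
        by (rule brunn_minkowski_disjoint_boxes[OF F(1,2) G(1,2), unfolded brunn_minkowski_def])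
      also have "\<dots> \<le> ?\<mu> (A + B)"
      proof (rule measure_mono_fmeasurable)
        show "\<Union>(F n) + \<Union>(G n) \<subseteq> A + B"
          by (rule set_plus_mono2[OF F(3) G(3)])
        show "\<Union>(F n) + \<Union>(G n) \<in> sets lebesgue"
          by (intro lebesgue_open open_set_plus disjoint_boxes_Union(1) F(1))
        show "A + B \<in> lmeasurable"
          using A B by (intro lmeasurable_open open_set_plus bounded_set_plus)
      qed
      finally show ?thesis .
    qed
    then show "\<exists>N. \<forall>n\<ge>N. (root ?n (?\<mu> (\<Union>(F n))) + root ?n (?\<mu> (\<Union>(G n)))) ^ ?n \<le> ?\<mu> (A + B)"
      by blast
  qed
  then have "root ?n ((root ?n (?\<mu> A) + root ?n (?\<mu> B)) ^ ?n) \<le> root ?n (?\<mu> (A + B))"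
    by (intro real_root_le_mono) simp_all
  then show ?thesis
    by (simp add: real_root_power_cancel)
qed


section \<open>The norm of a symmetric convex body\<close>

text \<open>The midpoint of an interior point and its mirror image is the origin.\<close>

lemma zero_in_interior:
  assumes "convex_body K" "o_symmetric K"
  shows "0 \<in> interior K"
proof -
  obtain x where x: "x \<in> interior K"
    using assms(1) by (auto simp: convex_body_def)
  then have "- x \<in> interior K"
    using interior_negations[of K] assms(2) by (force simp: o_symmetric_def)
  moreover have "convex (interior K)"
    using assms(1) by (simp add: convex_body_def)
  ultimately have "(1/2) *\<^sub>R x + (1/2) *\<^sub>R (- x) \<in> interior K"
    using x by (intro convexD) auto
  then show ?thesis
    by simp
qed

text \<open>This is the triangle inequality for the norm, in terms of the scaled bodies that are its balls.\<close>

lemma scaling_plus_scaling: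
  assumes K: "convex K" and st: "0 \<le> s" "0 \<le> t"
    and a: "a \<in> (*\<^sub>R) s ` K" and b: "b \<in> (*\<^sub>R) t ` K"
  shows "a + b \<in> (*\<^sub>R) (s + t) ` K"
proof (cases "s + t = 0")
  case True
  then have "s = 0" "t = 0"
    using st by simp_all
  then show ?thesis
    using a b by auto
next
  case False
  obtain x y where xy: "x \<in> K" "y \<in> K" "a = s *\<^sub>R x" "b = t *\<^sub>R y"
    using a b by blast
  have "(s / (s + t)) *\<^sub>R x + (t / (s + t)) *\<^sub>R y \<in> K"
    using False st xy by (intro convexD[OF K]) (simp_all add: add_divide_distrib[symmetric])
  moreover have "a + b = (s + t) *\<^sub>R ((s / (s + t)) *\<^sub>R x + (t / (s + t)) *\<^sub>R y)"
    using False xy by (simp add: scaleR_add_right)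
  ultimately show ?thesis
    by blast
qed

lemma scaling_mono:
  assumes "convex K" "0 \<in> K" "0 \<le> s" "s \<le> t"
  shows "(*\<^sub>R) s ` K \<subseteq> (*\<^sub>R) t ` K"
proof
  fix x assume "x \<in> (*\<^sub>R) s ` K"
  moreover have "0 \<in> (*\<^sub>R) (t - s) ` K"
    using assms(2) by force
  ultimately show "x \<in> (*\<^sub>R) t ` K"
    using scaling_plus_scaling[of K s "t - s" x 0] assms by simp
qed

lemma uminus_in_scaling:
  assumes "o_symmetric K" "x \<in> (*\<^sub>R) s ` K"
  shows "- x \<in> (*\<^sub>R) s ` K"
proof -
  obtain y where y: "y \<in> K" "x = s *\<^sub>R y"
    using assms(2) by blast
  have "- y \<in> uminus ` K"
    using y(1) by (rule imageI)
  then have "- y \<in> K"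
    using assms(1) by (simp only: o_symmetric_def)
  moreover have "- x = s *\<^sub>R (- y)"
    using y(2) by simp
  ultimately show ?thesis
    by blast
qed

text \<open>By compactness of \<open>K\<close> the least element in the definition of the norm is attained, and the
admissible factors are upward closed as \<open>K\<close> contains the origin.\<close>

lemma body_norm_le_iff:
  fixes K :: "'a::euclidean_space set"
  assumes K: "convex_body K" "o_symmetric K"
  shows "body_norm K x \<le> \<mu> \<longleftrightarrow> 0 \<le> \<mu> \<and> x \<in> (*\<^sub>R) \<mu> ` K"
proof -
  let ?P = "\<lambda>\<mu>. 0 \<le> \<mu> \<and> x \<in> (*\<^sub>R) \<mu> ` K"
  have cK: "compact K" "convex K" and z: "0 \<in> interior K"
    using K zero_in_interior by (auto simp: convex_body_def)
  obtain e where e: "0 < e" "e *\<^sub>R x \<in> K"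
    using z convex_interior_iff[OF cK(2), of 0] by auto
  define M where "M = 1 / e"
  have "x = M *\<^sub>R (e *\<^sub>R x)"
    using e(1) by (simp add: M_def)
  then have M: "0 \<le> M" "(M, e *\<^sub>R x) \<in> {p. fst p *\<^sub>R snd p = x}"
    using e(1) by (simp_all add: M_def)
  \<comment> \<open>Bounding the factor by one admissible value \<open>M\<close> makes the set of representations compact.\<close>
  let ?T = "({0..M} \<times> K) \<inter> {p. fst p *\<^sub>R snd p = x}"
  have "compact ?T"
    using cK(1) by (intro compact_Int_closed compact_Times closed_Collect_eq continuous_intros) simp_all
  moreover have "?T \<noteq> {}"
    using M e(2) by force
  ultimately obtain p where p: "p \<in> ?T" and min: "\<forall>q\<in>?T. fst p \<le> fst q"
    using continuous_attains_inf[of ?T fst] continuous_on_fst[OF continuous_on_id] by blast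
  have Pp: "?P (fst p)"
    using p by force
  have least: "fst p \<le> \<nu>" if \<nu>: "?P \<nu>" for \<nu>
  proof (cases "\<nu> \<le> M")
    case True
    obtain y where "y \<in> K" "x = \<nu> *\<^sub>R y"
      using \<nu> by blast
    then have "(\<nu>, y) \<in> ?T"
      using True \<nu> by simp
    with min have "fst p \<le> fst (\<nu>, y)"
      by (rule bspec)
    then show ?thesis
      by simp
  next
    case False
    then show ?thesis
      using p by auto
  qed
  have norm: "body_norm K x = fst p"
    unfolding body_norm_def by (rule Least_equality[of ?P, OF Pp least])
  show ?thesis
  proof
    assume "body_norm K x \<le> \<mu>"
    moreover have "0 \<in> K"
      using z interior_subset by blast
    ultimately show "?P \<mu>"
      using Pp scaling_mono[OF cK(2), of "fst p" \<mu>] norm by auto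
  next
    assume "?P \<mu>"
    then show "body_norm K x \<le> \<mu>"
      using least norm by simp
  qed
qed

lemma body_norm_minus:
  fixes K :: "'a::euclidean_space set"
  assumes K: "convex_body K" "o_symmetric K"
  shows "body_norm K (- x) = body_norm K x"
proof -
  have le: "body_norm K (- x) \<le> body_norm K x" for x
  proof -
    have "0 \<le> body_norm K x \<and> x \<in> (*\<^sub>R) (body_norm K x) ` K"
      using body_norm_le_iff[OF K, of x "body_norm K x"] by simp
    then show ?thesis
      using body_norm_le_iff[OF K] uminus_in_scaling[OF K(2)] by blast
  qed
  show ?thesis
    using le[of x] le[of "- x"] by simp
qed

text \<open>An interior point stays in \<open>K\<close> when it is stretched slightly.\<close>

lemma body_norm_less_of_interior:
  fixes K :: "'a::euclidean_space set"
  assumes K: "convex_body K" "o_symmetric K" and "0 < s" and w: "w \<in> interior K"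
  shows "body_norm K (s *\<^sub>R w) < s"
proof -
  have "convex K"
    using K by (simp add: convex_body_def)
  then obtain e where e: "0 < e" "w + e *\<^sub>R w \<in> K"
    using w convex_interior_iff[of K w] by auto
  have "s *\<^sub>R w = (s / (1 + e)) *\<^sub>R (w + e *\<^sub>R w)"
  proof -
    have "w + e *\<^sub>R w = (1 + e) *\<^sub>R w"
      by (simp add: algebra_simps)
    then show ?thesis
      using e(1) by simp
  qed
  then have "s *\<^sub>R w \<in> (*\<^sub>R) (s / (1 + e)) ` K"
    using e(2) by blast
  then have "body_norm K (s *\<^sub>R w) \<le> s / (1 + e)"
    using body_norm_le_iff[OF K] e(1) \<open>0 < s\<close> by simp
  also have "\<dots> < s"
    using e(1) \<open>0 < s\<close> by (simp add: field_simps)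
  finally show ?thesis .
qed

section \<open>Ball polyhedra of separated and of clustered centres\<close>

lemma body_ball_iff: "x \<in> body_ball K c r \<longleftrightarrow> x - c \<in> (*\<^sub>R) r ` K"
  unfolding body_ball_def by (auto simp: image_iff algebra_simps)

lemma ball_polyhedron_iff: "x \<in> ball_polyhedron K r X \<longleftrightarrow> (\<forall>c\<in>X. x - c \<in> (*\<^sub>R) r ` K)"
  by (simp add: ball_polyhedron_def body_ball_iff)

lemma compact_convex_ball_polyhedron:
  assumes "convex_body K" "X \<noteq> {}"
  shows "compact (ball_polyhedron K r X)" "convex (ball_polyhedron K r X)"
proof -
  have "compact (body_ball K c r)" "convex (body_ball K c r)" for c
    using assms(1) by (simp_all add: convex_body_def body_ball_def compact_affinity convex_affinity)
  then show "compact (ball_polyhedron K r X)" "convex (ball_polyhedron K r X)"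
    using assms(2) by (auto simp: ball_polyhedron_def intro!: compact_Inter convex_INT)
qed

lemma measure_scaled_translate:
  fixes S :: "'a::euclidean_space set"
  shows "measure lebesgue ((\<lambda>y. a + s *\<^sub>R y) ` S) = \<bar>s\<bar> ^ DIM('a) * measure lebesgue S"
  using measure_lebesgue_affine[of s a S] by (simp add: add.commute)

text \<open>The \<open>\<rho>\<close>-balls about the centres are a packing, and subtracting any of their points from a point
of the ball polyhedron leads into \<open>(r + \<rho>) K\<close>. The Brunn--Minkowski inequality for the ball
polyhedron and the mirrored packing therefore bounds its volume. Interiors are taken to have open
sets; for convex sets this does not change the volume.\<close>

lemma measure_ball_polyhedron_separated:
  fixes K :: "'a::euclidean_space set" and p :: "'i \<Rightarrow> 'a"
  assumes K: "convex_body K" "o_symmetric K" and r: "0 \<le> r" and \<rho>: "0 < \<rho>"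
    and I: "finite I" "I \<noteq> {}"
    and sep: "\<And>i j. i \<in> I \<Longrightarrow> j \<in> I \<Longrightarrow> i \<noteq> j \<Longrightarrow> 2 * \<rho> \<le> body_norm K (p i - p j)"
    and ne: "interior (ball_polyhedron K r (p ` I)) \<noteq> {}"
  shows "root DIM('a) (measure lebesgue (ball_polyhedron K r (p ` I)))
           \<le> (r + \<rho> - root DIM('a) (card I) * \<rho>) * root DIM('a) (measure lebesgue K)"
proof -
  let ?n = "DIM('a)" and ?\<mu> = "measure (lebesgue :: 'a measure)"
  let ?A = "ball_polyhedron K r (p ` I)"
  let ?piece = "\<lambda>i. (\<lambda>y. - p i + \<rho> *\<^sub>R y) ` interior K"
  let ?B = "\<Union>i\<in>I. ?piece i"
  have cK: "compact K" "convex K" "interior K \<noteq> {}"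
    using K by (auto simp: convex_body_def)
  have cA: "compact ?A" "convex ?A"
    using compact_convex_ball_polyhedron[OF K(1)] I(2) by auto
  have \<mu>_interior: "?\<mu> (interior S) = ?\<mu> S" if "compact S" "convex S" for S :: "'a set"
    using that by (intro measure_interior compact_imp_bounded negligible_convex_frontier)
  have op: "open (?piece i)" for i
    using \<rho> by (intro open_affinity) auto
  have bd: "bounded (?piece i)" for i
    using compact_imp_bounded[OF compact_affinity[OF cK(1), of "- p i" \<rho>]]
    by (rule bounded_subset) (auto dest: subsetD[OF interior_subset])
  have disj: "disjnt (?piece i) (?piece j)" if ij: "i \<in> I" "j \<in> I" "i \<noteq> j" for i j
  proof (rule ccontr)
    assume "\<not> disjnt (?piece i) (?piece j)"
    then obtain y z where y: "y \<in> interior K" and z: "z \<in> interior K"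
      and eq: "- p i + \<rho> *\<^sub>R y = - p j + \<rho> *\<^sub>R z"
      by (auto simp: disjnt_def)
    have "- z \<in> interior K"
      using z interior_negations[of K] K(2) by (force simp: o_symmetric_def)
    then have w: "(1/2) *\<^sub>R y + (1/2) *\<^sub>R (- z) \<in> interior K"
      using y cK(2) by (intro convexD[OF convex_interior]) auto
    \<comment> \<open>A common point would make the centres differ by an interior point of \<open>2 \<rho> K\<close>.\<close>
    have "p i - p j = (2 * \<rho>) *\<^sub>R ((1/2) *\<^sub>R y + (1/2) *\<^sub>R (- z))"
    proof -
      have "p i - p j = \<rho> *\<^sub>R y - \<rho> *\<^sub>R z"
        using eq by (simp add: algebra_simps)
      then show ?thesis
        by (simp add: scaleR_diff_right)
    qed
    then show False
      using body_norm_less_of_interior[OF K _ w, of "2 * \<rho>"] \<rho> sep[OF ij] by simp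
  qed
  have \<mu>B: "?\<mu> ?B = card I * (\<rho> ^ ?n * ?\<mu> K)"
  proof -
    have "?\<mu> ?B = (\<Sum>i\<in>I. ?\<mu> (?piece i))"
      using I(1) op bd disj
      by (intro measure_UNION') (auto simp: pairwise_def intro: lmeasurable_open)
    also have "\<dots> = (\<Sum>i\<in>I. \<rho> ^ ?n * ?\<mu> K)"
      using \<rho> \<mu>_interior[OF cK(1,2)] unfolding measure_scaled_translate by simp
    finally show ?thesis
      by simp
  qed
  have "interior ?A + ?B \<subseteq> (\<lambda>y. 0 + (r + \<rho>) *\<^sub>R y) ` K"
  proof
    fix x assume "x \<in> interior ?A + ?B"
    then obtain a i y where a: "a \<in> ?A" and i: "i \<in> I" and y: "y \<in> K"
      and x: "x = a + (- p i + \<rho> *\<^sub>R y)"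
      using interior_subset by (auto simp: set_plus_def; blast)
    have "(a - p i) + \<rho> *\<^sub>R y \<in> (*\<^sub>R) (r + \<rho>) ` K"
      using a i y r \<rho> by (intro scaling_plus_scaling cK(2)) (auto simp: ball_polyhedron_iff)
    then show "x \<in> (\<lambda>y. 0 + (r + \<rho>) *\<^sub>R y) ` K"
      by (simp add: x algebra_simps)
  qed
  then have "?\<mu> (interior ?A + ?B) \<le> ?\<mu> ((\<lambda>y. 0 + (r + \<rho>) *\<^sub>R y) ` K)"
    using cK(1)
    by (intro measure_mono_fmeasurable lebesgue_open open_set_plus lmeasurable_compact compact_affinity) auto
  also have "\<dots> = (r + \<rho>) ^ ?n * ?\<mu> K"
    unfolding measure_scaled_translate using r \<rho> by simp
  finally have upper: "?\<mu> (interior ?A + ?B) \<le> (r + \<rho>) ^ ?n * ?\<mu> K" .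
  have "root ?n (?\<mu> (interior ?A)) + root ?n (?\<mu> ?B) \<le> root ?n (?\<mu> (interior ?A + ?B))"
  proof (rule brunn_minkowski_open)
    show "bounded (interior ?A)"
      using cA(1) by (simp add: bounded_interior compact_imp_bounded)
    show "?B \<noteq> {}"
      using I(2) cK(3) by auto
    show "bounded ?B"
      using I(1) bd by (intro bounded_UN) auto
  qed (use ne op in auto)
  also have "\<dots> \<le> root ?n ((r + \<rho>) ^ ?n * ?\<mu> K)"
    using upper by (intro real_root_le_mono) simp_all
  also have "\<dots> = (r + \<rho>) * root ?n (?\<mu> K)"
    using r \<rho> by (simp add: real_root_mult real_root_power_cancel)
  finally have "root ?n (?\<mu> ?A) + root ?n (card I * (\<rho> ^ ?n * ?\<mu> K)) \<le> (r + \<rho>) * root ?n (?\<mu> K)"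
    unfolding \<mu>B \<mu>_interior[OF cA] .
  moreover have "root ?n (card I * (\<rho> ^ ?n * ?\<mu> K)) = root ?n (card I) * \<rho> * root ?n (?\<mu> K)"
    using \<rho> by (simp add: real_root_mult real_root_power_cancel)
  ultimately show ?thesis
    unfolding left_diff_distrib by linarith
qed

lemma body_ball_subset_ball_polyhedron:
  assumes K: "convex_body K" "o_symmetric K" and s: "0 \<le> s"
    and near: "\<And>x. x \<in> X \<Longrightarrow> body_norm K (c - x) \<le> lam"
  shows "body_ball K c s \<subseteq> ball_polyhedron K (s + lam) X"
proof
  fix y assume y: "y \<in> body_ball K c s"
  show "y \<in> ball_polyhedron K (s + lam) X"
    unfolding ball_polyhedron_iff
  proof
    fix x assume "x \<in> X"
    then have "0 \<le> lam \<and> c - x \<in> (*\<^sub>R) lam ` K"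
      by (rule body_norm_le_iff[OF K, THEN iffD1, OF near])
    then have "(y - c) + (c - x) \<in> (*\<^sub>R) (s + lam) ` K"
      using y s K by (intro scaling_plus_scaling) (auto simp: body_ball_iff convex_body_def)
    then show "y - x \<in> (*\<^sub>R) (s + lam) ` K"
      by simp
  qed
qed

theorem theorem4:
  fixes K :: "(real ^ 'n) set"
    and p q :: "nat \<Rightarrow> real ^ 'n"
    and r lam :: real
    and N :: nat
  assumes "CARD('n) > 1"
    and "r > 0"
    and "lam > 0"
    and "N \<ge> 3 ^ CARD('n)"
    and "convex_body K"
    and "o_symmetric K"
    and "generating_set K"
    and "uniform_contraction K lam N q p"
  shows "measure lebesgue (ball_polyhedron K r (p ` {1..N}))
           \<le> measure lebesgue (ball_polyhedron K r (q ` {1..N}))"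
proof -
  let ?d = "CARD('n)" and ?\<mu> = "measure (lebesgue :: (real ^ 'n) measure)"
  let ?P = "ball_polyhedron K r (p ` {1..N})" and ?Q = "ball_polyhedron K r (q ` {1..N})"
  note K = assms(5,6)
  have N: "1 \<le> N"
    using assms(4) one_le_power[of "3::nat" ?d] by linarith
  have cK: "compact K" "convex K" "interior K \<noteq> {}"
    using K by (auto simp: convex_body_def)
  have dist: "body_norm K (q i - q j) \<le> lam \<and> lam \<le> body_norm K (p i - p j)"
    if "i \<in> {1..N}" "j \<in> {1..N}" "i \<noteq> j" for i j
  proof (cases "i < j")
    case True
    then show ?thesis
      using assms(8) that by (simp add: uniform_contraction_def)
  next
    case False
    then have "body_norm K (q j - q i) \<le> lam \<and> lam \<le> body_norm K (p j - p i)"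
      using assms(8) that by (simp add: uniform_contraction_def)
    then show ?thesis
      using body_norm_minus[OF K, of "q i - q j"] body_norm_minus[OF K, of "p i - p j"] by simp
  qed
  show ?thesis
  proof (cases "interior ?P = {}")
    case True
    have "convex ?P"
      using compact_convex_ball_polyhedron[OF K(1)] N by simp
    then have "negligible ?P"
      using True by (simp add: negligible_convex_interior)
    then show ?thesis
      by (simp add: negligible_imp_measure0)
  next
    case False
    have \<mu>K: "0 < root ?d (?\<mu> K)"
    proof -
      have "\<not> negligible K"
        using cK by (simp add: negligible_convex_interior)
      then show ?thesis
        using lmeasurable_compact[OF cK(1)] by (simp add: negligible_iff_measure zero_less_measure_iff)
    qed
    have "root ?d (?\<mu> ?P) \<le> (r + lam / 2 - root ?d N * (lam / 2)) * root ?d (?\<mu> K)"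
      using measure_ball_polyhedron_separated[OF K, of r "lam / 2" "{1..N}" p] dist assms(2,3) False N
      by simp
    also have "\<dots> \<le> (r - lam) * root ?d (?\<mu> K)"
    proof (rule mult_right_mono)
      have "(3::real) = root ?d (3 ^ ?d)"
        by (simp add: real_root_power_cancel)
      also have "\<dots> \<le> root ?d N"
        using assms(4) by (intro real_root_le_mono) (simp_all flip: of_nat_le_iff)
      finally have "3 * (lam / 2) \<le> root ?d N * (lam / 2)"
        using assms(3) by (intro mult_right_mono) simp_all
      then show "r + lam / 2 - root ?d N * (lam / 2) \<le> r - lam"
        by linarith
    qed (use \<mu>K in simp)
    finally have P: "root ?d (?\<mu> ?P) \<le> (r - lam) * root ?d (?\<mu> K)" .
    \<comment> \<open>The sign of \<open>r - lam\<close> comes from the bound itself: a root of a volume is nonnegative.\<close>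
    have "0 \<le> (r - lam) * root ?d (?\<mu> K)"
      using P by (rule order_trans[rotated]) simp
    then have rlam: "0 \<le> r - lam"
      using \<mu>K by (simp add: zero_le_mult_iff)
    have "?\<mu> ?P = root ?d (?\<mu> ?P) ^ ?d"
      by simp
    also have "\<dots> \<le> ((r - lam) * root ?d (?\<mu> K)) ^ ?d"
      using P by (intro power_mono) simp_all
    also have "\<dots> = (r - lam) ^ ?d * ?\<mu> K"
      by (simp add: power_mult_distrib)
    also have "\<dots> = ?\<mu> (body_ball K (q 1) (r - lam))"
      using rlam by (simp add: body_ball_def measure_scaled_translate)
    also have "\<dots> \<le> ?\<mu> ?Q"
    proof (rule measure_mono_fmeasurable)
      have "body_norm K 0 \<le> lam"
        using assms(3) zero_in_interior[OF K] interior_subset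
        by (force simp: body_norm_le_iff[OF K] image_iff)
      then have "body_norm K (q 1 - q i) \<le> lam" if "i \<in> {1..N}" for i
        using dist[of 1 i] N that by (cases "i = 1") auto
      then show "body_ball K (q 1) (r - lam) \<subseteq> ?Q"
        using body_ball_subset_ball_polyhedron[OF K rlam, of "q ` {1..N}" "q 1" lam]
        by (simp only: diff_add_cancel) blast
      show "body_ball K (q 1) (r - lam) \<in> sets lebesgue"
        unfolding body_ball_def
        by (intro fmeasurableD lmeasurable_compact compact_affinity cK(1))
      show "?Q \<in> lmeasurable"
        using compact_convex_ball_polyhedron(1)[OF K(1)] N by (intro lmeasurable_compact) simp
    qed
    finally show ?thesis .
  qed
qed

end
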